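(* Let $(\mathcal W\times\mathcal T,\mathbf K(W|T))$ be a transition probability space and let $\mathbf X:\mathcal W\times\mathcal T\dashrightarrow\mathcal X$, $\mathbf Y:\mathcal W\times\mathcal T\dashrightarrow\mathcal Y$, $\mathbf Z:\mathcal W\times\mathcal T\dashrightarrow\mathcal Z$ be transitional random variables. Write $\perp\!\!\!\perp$ for transitional conditional independence $\perp\!\!\!\perp_{\mathbf K(W|T)}$. Then: l) (Restricted Symmetry) $(\mathbf X\perp\!\!\!\perp\mathbf Y\mid\mathbf Z)\land(\mathbf Y\perp\!\!\!\perp\boldsymbol\delta_\ast\mid\mathbf Z)\implies\mathbf Y\perp\!\!\!\perp\mathbf X\mid\mathbf Z$. m) ($\mathbf T$-Restricted Symmetry) If $(\mathcal Y,\mathcal Z,\mathcal T)$ is a disintegration triple, then $\mathbf X\perp\!\!\!\perp\mathbf Y\mid\mathbf Z\otimes\mathbf T\implies\mathbf Y\perp\!\!\!\perp\mathbf X\mid\mathbf Z\otimes\mathbf T$. n) (Symmetry) If $\mathcal T=\{\ast\}$ is the one-point space and $(\mathcal Y,\mathcal Z,\{\ast\})$ is a disintegration triple, then $\mathbf X\perp\!\!\!\perp\mathbf Y\mid\mathbf Z\implies\mathbf Y\perp\!\!\!\perp\mathbf X\mid\mathbf Z$.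
   Context: A Markov kernel $\mathbf K(W|T):\mathcal T\dashrightarrow\mathcal W$ between measurable spaces is a map $(D,t)\mapsto\mathbf K(W\in D|T=t)\in[0,1]$ that is a probability measure in the measurable set $D\subseteq\mathcal W$ for each $t$ and measurable in $t$ for each $D$. Product spaces carry product $\sigma$-algebras. For kernels $\mathbf Q(X|Z):\mathcal Z\dashrightarrow\mathcal X$ and $\mathbf K(Y,Z|T):\mathcal T\dashrightarrow\mathcal Y\times\mathcal Z$ the product $\mathbf Q(X|Z)\otimes\mathbf K(Y,Z|T):\mathcal T\dashrightarrow\mathcal X\times\mathcal Y\times\mathcal Z$ is the kernel whose value on $A\times B\times C$ at $t$ is $\int\mathbf 1_B(y)\mathbf 1_C(z)\,\mathbf Q(X\in A|Z=z)\,\mathbf K((Y,Z)\in d(y,z)|T=t)$. A transition probability space is a pair $(\mathcal W\times\mathcal T,\mathbf K(W|T))$ with $\mathbf K(W|T):\mathcal T\dashrightarrow\mathcal W$ a Markov kernel. A transitional random variable is a Markov kernel $\mathbf X:\mathcal W\times\mathcal T\dashrightarrow\mathcal X$ to a measurable space. $\mathbf X\otimes\mathbf Y$ is the kernel sending $(w,t)$ to the product measure of $\mathbf X(\cdot|w,t)$ and $\mathbf Y(\cdot|w,t)$. The joint kernel of $\mathbf X,\mathbf Y,\mathbf Z$ is $\mathbf K(X,Y,Z|T=t)(E)=\int(\mathbf X\otimes\mathbf Y\otimes\mathbf Z)(E|w,t)\,\mathbf K(W\in dw|T=t)$; $\mathbf K(Y,Z|T)$ etc. denote its marginals. $\mathbf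 T$ is the Dirac kernel $(w,t)\mapsto\boldsymbol\delta_t$ on $\mathcal T$, and $\boldsymbol\delta_\ast$ is the constant transitional random variable with values in the one-point space $\{\ast\}$. Transitional conditional independence: $\mathbf X\perp\!\!\!\perp_{\mathbf K(W|T)}\mathbf Y\mid\mathbf Z$ means that there exists a Markov kernel $\mathbf Q(X|Z):\mathcal Z\dashrightarrow\mathcal X$ with $\mathbf K(X,Y,Z|T)=\mathbf Q(X|Z)\otimes\mathbf K(Y,Z|T)$. A triple $(\mathcal X,\mathcal Y,\mathcal Z)$ of measurable spaces is a disintegration triple if every Markov kernel $\mathbf K(X,Y|Z):\mathcal Z\dashrightarrow\mathcal X\times\mathcal Y$ admits a Markov kernel $\mathbf K(X|Y,Z):\mathcal Y\times\mathcal Z\dashrightarrow\mathcal X$ with $\mathbf K(X\in A,Y\in B|Z=z)=\int_B\mathbf K(X\in A|Y=y,Z=z)\,\mathbf K(Y\in dy|Z=z)$ for all measurable $A,B$ and all $z$. *)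

theory Defs
  imports "HOL-Probability.Probability"
begin

text \<open>
  A value of type \<open>'a measure\<close> plays two roles here: as a measurable space (only \<open>space\<close> and
  \<open>sets\<close> matter) and as a value of a Markov kernel. A Markov kernel from \<open>M\<close> to \<open>N\<close> is a measurable
  map into \<open>prob_algebra N\<close>; the next lemma unfolds this. Kernels are only constrained on \<open>space M\<close>,
  so equality of kernels is always stated for points of \<open>space M\<close>.
\<close>

abbreviation markov_kernel :: "'a measure \<Rightarrow> 'b measure \<Rightarrow> ('a \<Rightarrow> 'b measure) \<Rightarrow> bool" where
  "markov_kernel M N K \<equiv> K \<in> M \<rightarrow>\<^sub>M prob_algebra N"

lemma markov_kernel_iff:
  "markov_kernel M N K \<longleftrightarrow>
    (\<forall>t\<in>space M. prob_space (K t) \<and> sets (K t) = sets N) \<and>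
    (\<forall>D\<in>sets N. (\<lambda>t. emeasure (K t) D) \<in> borel_measurable M)"
proof
  assume K: "markov_kernel M N K"
  have "prob_space (K t) \<and> sets (K t) = sets N" if "t \<in> space M" for t
    using measurable_space[OF K that] by (simp add: space_prob_algebra)
  moreover have "(\<lambda>t. emeasure (K t) D) \<in> borel_measurable M" if "D \<in> sets N" for D
    using measurable_emeasure_kernel[OF measurable_prob_algebraD[OF K] that] .
  ultimately show "(\<forall>t\<in>space M. prob_space (K t) \<and> sets (K t) = sets N) \<and>
    (\<forall>D\<in>sets N. (\<lambda>t. emeasure (K t) D) \<in> borel_measurable M)" by blast
next
  assume *: "(\<forall>t\<in>space M. prob_space (K t) \<and> sets (K t) = sets N) \<and>
    (\<forall>D\<in>sets N. (\<lambda>t. emeasure (K t) D) \<in> borel_measurable M)"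
  then show "markov_kernel M N K"
    by (auto intro!: measurable_prob_algebraI measurable_subprob_algebra
        prob_space_imp_subprob_space)
qed

definition kernel_tensor ::
    "('p \<Rightarrow> 'a measure) \<Rightarrow> ('p \<Rightarrow> 'b measure) \<Rightarrow> 'p \<Rightarrow> ('a \<times> 'b) measure"  (infixr "\<otimes>\<^sub>K" 75) where
  "X \<otimes>\<^sub>K Y = (\<lambda>p. X p \<Otimes>\<^sub>M Y p)"

definition T_kernel :: "'t measure \<Rightarrow> 'w \<times> 't \<Rightarrow> 't measure" where
  "T_kernel MT = (\<lambda>(w, t). return MT t)"

abbreviation point_space :: "unit measure" where
  "point_space \<equiv> count_space UNIV"

definition delta_star :: "'w \<times> 't \<Rightarrow> unit measure" where
  "delta_star = (\<lambda>_. return point_space ())"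

text \<open>
  The kernel obtained by integrating \<open>X(\<cdot> | w, t)\<close> against \<open>K(dw | t)\<close>; for a tensor product of transitional random variables this is their joint kernel.
\<close>

definition joint_kernel ::
    "('t \<Rightarrow> 'w measure) \<Rightarrow> ('w \<times> 't \<Rightarrow> 'x measure) \<Rightarrow> 't \<Rightarrow> 'x measure" where
  "joint_kernel K X = (\<lambda>t. K t \<bind> (\<lambda>w. X (w, t)))"

lemma emeasure_joint_kernel:
  assumes K: "markov_kernel MT MW K" and X: "markov_kernel (MW \<Otimes>\<^sub>M MT) MX X"
    and t: "t \<in> space MT" and E: "E \<in> sets MX"
  shows "emeasure (joint_kernel K X t) E = (\<integral>\<^sup>+w. emeasure (X (w, t)) E \<partial>K t)"
proof -
  have Kt: "prob_space (K t)" "sets (K t) = sets MW"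
    using K t by (simp_all add: markov_kernel_iff)
  have "(\<lambda>w. X (w, t)) \<in> MW \<rightarrow>\<^sub>M subprob_algebra MX"
    using measurable_prob_algebraD[OF X] t by measurable
  then have "(\<lambda>w. X (w, t)) \<in> K t \<rightarrow>\<^sub>M subprob_algebra MX"
    by (simp add: measurable_cong_sets[OF Kt(2) refl])
  then show ?thesis
    unfolding joint_kernel_def using E prob_space.not_empty[OF Kt(1)]
    by (intro emeasure_bind) auto
qed

text \<open>
  Given \<open>(y, z)\<close> drawn from \<open>K t\<close>, draw \<open>x\<close> from \<open>Q z\<close> and return \<open>(x, y, z)\<close>. The measure
  \<open>return (K t) yz\<close> is the Dirac measure at \<open>yz\<close> on the \<open>\<sigma>\<close>-algebra of \<open>K t\<close>.
\<close>

definition kernel_product ::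
    "('z \<Rightarrow> 'x measure) \<Rightarrow> ('t \<Rightarrow> ('y \<times> 'z) measure) \<Rightarrow> 't \<Rightarrow> ('x \<times> 'y \<times> 'z) measure" where
  "kernel_product Q K = (\<lambda>t. K t \<bind> (\<lambda>yz. Q (snd yz) \<Otimes>\<^sub>M return (K t) yz))"

lemma emeasure_kernel_product:
  assumes Q: "markov_kernel MZ MX Q" and K: "markov_kernel MT (MY \<Otimes>\<^sub>M MZ) K"
    and t: "t \<in> space MT" and A: "A \<in> sets MX" and B: "B \<in> sets MY" and C: "C \<in> sets MZ"
  shows "emeasure (kernel_product Q K t) (A \<times> B \<times> C) =
    (\<integral>\<^sup>+yz. indicator B (fst yz) * indicator C (snd yz) * emeasure (Q (snd yz)) A \<partial>K t)"
proof -
  have Kt: "prob_space (K t)" "sets (K t) = sets (MY \<Otimes>\<^sub>M MZ)"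
    using K t by (simp_all add: markov_kernel_iff)
  have spKt: "space (K t) = space (MY \<Otimes>\<^sub>M MZ)"
    by (rule sets_eq_imp_space_eq) (rule Kt(2))
  have ret: "return (K t) = return (MY \<Otimes>\<^sub>M MZ)"
    by (rule return_sets_cong) (rule Kt(2))
  have Qs: "(\<lambda>yz. Q (snd yz)) \<in> MY \<Otimes>\<^sub>M MZ \<rightarrow>\<^sub>M prob_algebra MX"
    using Q by measurable
  have R: "return (MY \<Otimes>\<^sub>M MZ) \<in> MY \<Otimes>\<^sub>M MZ \<rightarrow>\<^sub>M prob_algebra (MY \<Otimes>\<^sub>M MZ)"
    by (rule measurable_return_prob_space)
  have "(\<lambda>yz. Q (snd yz) \<Otimes>\<^sub>M return (MY \<Otimes>\<^sub>M MZ) yz) \<in>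
      MY \<Otimes>\<^sub>M MZ \<rightarrow>\<^sub>M prob_algebra (MX \<Otimes>\<^sub>M MY \<Otimes>\<^sub>M MZ)"
    using Qs R by measurable
  then have "(\<lambda>yz. Q (snd yz) \<Otimes>\<^sub>M return (K t) yz) \<in>
      K t \<rightarrow>\<^sub>M subprob_algebra (MX \<Otimes>\<^sub>M MY \<Otimes>\<^sub>M MZ)"
    unfolding ret measurable_cong_sets[OF Kt(2) refl] by (rule measurable_prob_algebraD)
  then have "emeasure (kernel_product Q K t) (A \<times> B \<times> C) =
      (\<integral>\<^sup>+yz. emeasure (Q (snd yz) \<Otimes>\<^sub>M return (K t) yz) (A \<times> B \<times> C) \<partial>K t)"
    unfolding kernel_product_def using A B C prob_space.not_empty[OF Kt(1)]
    by (intro emeasure_bind) auto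
  also have "\<dots> = (\<integral>\<^sup>+yz. indicator B (fst yz) * indicator C (snd yz) *
      emeasure (Q (snd yz)) A \<partial>K t)"
  proof (rule nn_integral_cong)
    fix yz assume yz: "yz \<in> space (K t)"
    then have "snd yz \<in> space MZ"
      by (auto simp: spKt space_pair_measure)
    then have "sets (Q (snd yz)) = sets MX"
      using Q by (simp add: markov_kernel_iff)
    moreover have "prob_space (return (K t) yz)"
      using yz by (rule prob_space_return)
    ultimately have "emeasure (Q (snd yz) \<Otimes>\<^sub>M return (K t) yz) (A \<times> B \<times> C) =
        emeasure (Q (snd yz)) A * emeasure (return (K t) yz) (B \<times> C)"
      using A B C Kt(2)
      by (intro sigma_finite_measure.emeasure_pair_measure_Times
          prob_space_imp_sigma_finite) auto
    then show "emeasure (Q (snd yz) \<Otimes>\<^sub>M return (K t) yz) (A \<times> B \<times> C) =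
        indicator B (fst yz) * indicator C (snd yz) * emeasure (Q (snd yz)) A"
      using B C Kt(2) by (cases yz) (auto split: split_indicator)
  qed
  finally show ?thesis .
qed

text \<open>
  Transitional conditional independence of \<open>X\<close> and \<open>Y\<close> given \<open>Z\<close>. The marginal
  \<open>K(Y, Z | T)\<close> is the image of the joint kernel \<open>K(X, Y, Z | T)\<close> under \<open>snd\<close>.
\<close>

definition trans_cond_indep ::
    "'t measure \<Rightarrow> ('t \<Rightarrow> 'w measure) \<Rightarrow>
     'x measure \<Rightarrow> ('w \<times> 't \<Rightarrow> 'x measure) \<Rightarrow>
     'y measure \<Rightarrow> ('w \<times> 't \<Rightarrow> 'y measure) \<Rightarrow>
     'z measure \<Rightarrow> ('w \<times> 't \<Rightarrow> 'z measure) \<Rightarrow> bool" where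
  "trans_cond_indep MT K MX X MY Y MZ Z \<longleftrightarrow>
    (\<exists>Q. markov_kernel MZ MX Q \<and>
      (\<forall>t\<in>space MT.
        joint_kernel K (X \<otimes>\<^sub>K Y \<otimes>\<^sub>K Z) t =
        kernel_product Q
          (\<lambda>t. distr (joint_kernel K (X \<otimes>\<^sub>K Y \<otimes>\<^sub>K Z) t) (MY \<Otimes>\<^sub>M MZ) snd) t))"

definition disintegration_triple :: "'x measure \<Rightarrow> 'y measure \<Rightarrow> 'z measure \<Rightarrow> bool" where
  "disintegration_triple MX MY MZ \<longleftrightarrow>
    (\<forall>K. markov_kernel MZ (MX \<Otimes>\<^sub>M MY) K \<longrightarrow>
      (\<exists>L. markov_kernel (MY \<Otimes>\<^sub>M MZ) MX L \<and>
        (\<forall>A\<in>sets MX. \<forall>B\<in>sets MY. \<forall>z\<in>space MZ.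
          emeasure (K z) (A \<times> B) =
          (\<integral>\<^sup>+y\<in>B. emeasure (L (y, z)) A \<partial>distr (K z) MY snd))))"

end

theory Submission
  imports Defs
begin

text \<open>
  Both sides of the defining identity of transitional conditional independence are probability
  measures, so it suffices to compare them on boxes \<open>A \<times> B \<times> C\<close>. There, the independence of \<open>X\<close>
  and \<open>Y\<close> given \<open>Z\<close> with witness \<open>Q\<close> becomes, for every \<open>t\<close>, an identity between integrals over
  \<open>w\<close>: \<open>\<integral> X(A|w,t) Y(B|w,t) Z(C|w,t) K(dw|t) = \<integral> Y(B|w,t) (\<integral>\<^bsub>C\<^esub> Q(A|z) Z(dz|w,t)) K(dw|t)\<close>
  (\<open>trans_cond_indep_iff_rectangles\<close>). Taking for \<open>B\<close> the whole space shows that \<open>Q\<close> is also a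
  version of the conditional distribution of \<open>X\<close> given \<open>Z\<close>, the same one for all \<open>t\<close>. In the same
  way, independence of \<open>Y\<close> and \<open>\<delta>\<^sub>*\<close> given \<open>Z\<close> says exactly that some kernel \<open>P\<close> from the space of
  \<open>Z\<close> is a version of the conditional distribution of \<open>Y\<close> given \<open>Z\<close>, again for all \<open>t\<close> at once.

  Restricted symmetry is then the computation
  \<open>\<integral> Y(B) X(A) Z(C) dK = \<integral> Y(B) (\<integral>\<^bsub>C\<^esub> Q(A|z) Z(dz)) dK = \<integral> (\<integral>\<^bsub>C\<^esub> P(B|z) Q(A|z) Z(dz)) dK
    = \<integral> X(A) (\<integral>\<^bsub>C\<^esub> P(B|z) Z(dz)) dK\<close>,
  whose third term treats the two variables alike. The last two equalities replace the weight
  \<open>Y(B|w,t)\<close> by \<open>P(B|z)\<close> and \<open>X(A|w,t)\<close> by \<open>Q(A|z)\<close>. This is legitimate against every measurable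
  nonnegative function of \<open>z\<close> as soon as it is so against indicator functions
  (\<open>nn_integral_weighted_mixture\<close>).

  The other two symmetries reduce to this one: the disintegration property, applied to the kernel
  \<open>K(Y, Z | T)\<close>, yields a conditional distribution \<open>L\<close> of \<open>Y\<close> which may depend on \<open>z\<close> and \<open>t\<close>.
  This dependence is harmless if \<open>T\<close> is part of the conditioning, and also if there is only one
  \<open>t\<close>. In both cases \<open>Y\<close> is therefore independent of \<open>\<delta>\<^sub>*\<close>.
\<close>

section \<open>Measures on triple products and mixtures of measures\<close>

lemma measure_eqI_prob_triple:
  assumes P: "P \<in> space (prob_algebra (MX \<Otimes>\<^sub>M MY \<Otimes>\<^sub>M MZ))"
    and Q: "Q \<in> space (prob_algebra (MX \<Otimes>\<^sub>M MY \<Otimes>\<^sub>M MZ))"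
    and eq: "\<And>A B C. A \<in> sets MX \<Longrightarrow> B \<in> sets MY \<Longrightarrow> C \<in> sets MZ \<Longrightarrow>
      emeasure P (A \<times> B \<times> C) = emeasure Q (A \<times> B \<times> C)"
  shows "P = Q"
proof -
  define E where "E = {A \<times> B \<times> C | A B C. A \<in> sets MX \<and> B \<in> sets MY \<and> C \<in> sets MZ}"
  let ?S = "space MX \<times> space MY \<times> space MZ"
  let ?R = "{B \<times> C | B C. B \<in> sets MY \<and> C \<in> sets MZ}"
  have Eb: "sets (MY \<Otimes>\<^sub>M MZ) = sigma_sets (space (MY \<Otimes>\<^sub>M MZ)) ?R"
    by (simp add: sets_pair_measure space_pair_measure)
  have Rsub: "?R \<subseteq> Pow (space (MY \<Otimes>\<^sub>M MZ))"
    by (auto simp: space_pair_measure dest: sets.sets_into_space)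
  have "sets (MX \<Otimes>\<^sub>M MY \<Otimes>\<^sub>M MZ) = sets (sigma (space MX \<times> space (MY \<Otimes>\<^sub>M MZ))
      {A \<times> D | A D. A \<in> sets MX \<and> D \<in> ?R})"
    by (rule sets_pair_eq[where Ca="{space MX}" and Cb="{space (MY \<Otimes>\<^sub>M MZ)}", OF _ _ _ _ _ Rsub Eb])
      (auto simp: sets.space_closed sets.sigma_sets_eq space_pair_measure)
  then have "sets (MX \<Otimes>\<^sub>M MY \<Otimes>\<^sub>M MZ) = sets (sigma ?S {A \<times> D | A D. A \<in> sets MX \<and> D \<in> ?R})"
    by (simp add: space_pair_measure)
  also have "{A \<times> D | A D. A \<in> sets MX \<and> D \<in> ?R} = E"
    unfolding E_def by blast
  finally have gen: "sets (MX \<Otimes>\<^sub>M MY \<Otimes>\<^sub>M MZ) = sets (sigma ?S E)" .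
  have sub: "E \<subseteq> Pow ?S"
    unfolding E_def by (auto dest: sets.sets_into_space)
  interpret P: prob_space P using P by (simp add: space_prob_algebra)
  show ?thesis
  proof (rule measure_eqI_generator_eq[where A="\<lambda>_. ?S" and \<Omega>="?S" and E=E])
    show "Int_stable E"
    proof (rule Int_stableI)
      fix U V assume "U \<in> E" "V \<in> E"
      then obtain A B C A' B' C' where "U = A \<times> B \<times> C" "V = A' \<times> B' \<times> C'"
        "A \<in> sets MX" "B \<in> sets MY" "C \<in> sets MZ" "A' \<in> sets MX" "B' \<in> sets MY" "C' \<in> sets MZ"
        unfolding E_def by blast
      moreover from this have "U \<inter> V = (A \<inter> A') \<times> (B \<inter> B') \<times> (C \<inter> C')" by blast
      ultimately show "U \<inter> V \<in> E" unfolding E_def by blast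
    qed
    show "emeasure P ?S \<noteq> \<infinity>" by simp
  qed (use P Q gen sub eq in \<open>auto simp: space_prob_algebra E_def\<close>)
qed

text \<open>
  The hypothesis says that the mixture of the measures \<open>N w\<close> with weights \<open>a w\<close> has density \<open>p\<close>
  with respect to the unweighted mixture; the conclusion integrates \<open>h\<close> against both. In the
  application \<open>a\<close> is the conditional probability of an event given \<open>w\<close>, and \<open>p\<close> is its conditional
  probability given \<open>z\<close>.
\<close>

lemma nn_integral_weighted_mixture:
  assumes a: "a \<in> borel_measurable M" and N: "N \<in> M \<rightarrow>\<^sub>M subprob_algebra S"
    and ne: "space M \<noteq> {}"
    and p: "p \<in> borel_measurable S" and h: "h \<in> borel_measurable S"
    and eq: "\<And>C. C \<in> sets S \<Longrightarrow>
      (\<integral>\<^sup>+w. a w * emeasure (N w) C \<partial>M) = (\<integral>\<^sup>+w. \<integral>\<^sup>+z. p z * indicator C z \<partial>N w \<partial>M)"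
  shows "(\<integral>\<^sup>+w. a w * (\<integral>\<^sup>+z. h z \<partial>N w) \<partial>M) = (\<integral>\<^sup>+w. \<integral>\<^sup>+z. p z * h z \<partial>N w \<partial>M)"
proof -
  have Nd: "N \<in> density M a \<rightarrow>\<^sub>M subprob_algebra S"
    using N by (simp cong: measurable_cong_sets)
  have sN: "sets (M \<bind> N) = sets S" "sets (density M a \<bind> N) = sets S"
    using ne by (auto intro!: sets_bind sets_kernel[OF N])
  have "density M a \<bind> N = density (M \<bind> N) p"
  proof (rule measure_eqI)
    fix C assume "C \<in> sets (density M a \<bind> N)"
    then have C: "C \<in> sets S" by (simp add: sN)
    have "emeasure (density M a \<bind> N) C = (\<integral>\<^sup>+w. a w * emeasure (N w) C \<partial>M)"
      using ne Nd C a measurable_emeasure_kernel[OF N C]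
      by (simp add: emeasure_bind nn_integral_density)
    also have "\<dots> = (\<integral>\<^sup>+z. p z * indicator C z \<partial>(M \<bind> N))"
      using eq[OF C] p C by (simp add: nn_integral_bind[OF _ N])
    also have "\<dots> = emeasure (density (M \<bind> N) p) C"
      using p C sN by (simp add: emeasure_density cong: measurable_cong_sets)
    finally show "emeasure (density M a \<bind> N) C = emeasure (density (M \<bind> N) p) C" .
  qed (simp add: sN)
  then have "(\<integral>\<^sup>+z. h z \<partial>(density M a \<bind> N)) = (\<integral>\<^sup>+z. h z \<partial>density (M \<bind> N) p)"
    by simp
  moreover have "(\<integral>\<^sup>+z. h z \<partial>(density M a \<bind> N)) = (\<integral>\<^sup>+w. a w * (\<integral>\<^sup>+z. h z \<partial>N w) \<partial>M)"
    using a measurable_compose[OF N nn_integral_measurable_subprob_algebra[OF h]]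
    by (simp add: nn_integral_bind[OF h Nd] nn_integral_density)
  moreover have "(\<integral>\<^sup>+z. h z \<partial>density (M \<bind> N) p) = (\<integral>\<^sup>+w. \<integral>\<^sup>+z. p z * h z \<partial>N w \<partial>M)"
  proof -
    have "(\<integral>\<^sup>+z. h z \<partial>density (M \<bind> N) p) = (\<integral>\<^sup>+z. p z * h z \<partial>(M \<bind> N))"
      using p h sN(1) by (intro nn_integral_density) (simp_all cong: measurable_cong_sets)
    then show ?thesis
      using p h by (simp add: nn_integral_bind[OF _ N])
  qed
  ultimately show ?thesis by simp
qed

section \<open>Joint kernels, their marginals and kernel products\<close>

lemma markov_kernel_joint_kernel:
  assumes K: "markov_kernel MT MW K" and X: "markov_kernel (MW \<Otimes>\<^sub>M MT) MX X"
  shows "markov_kernel MT MX (joint_kernel K X)"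
proof -
  have "(\<lambda>(t, w). X (w, t)) \<in> MT \<Otimes>\<^sub>M MW \<rightarrow>\<^sub>M prob_algebra MX"
    using X by measurable
  then show ?thesis
    unfolding joint_kernel_def by (intro measurable_bind_prob_space2[OF K]) simp
qed

lemma markov_kernel_tensor:
  assumes "markov_kernel M MX X" and "markov_kernel M MY Y"
  shows "markov_kernel M (MX \<Otimes>\<^sub>M MY) (X \<otimes>\<^sub>K Y)"
  unfolding kernel_tensor_def using assms by measurable

lemma markov_kernel_section:
  assumes "markov_kernel (MW \<Otimes>\<^sub>M MT) MX X" and "t \<in> space MT"
  shows "markov_kernel MW MX (\<lambda>w. X (w, t))"
  using assms by measurable

lemma nn_integral_joint_kernel:
  assumes K: "markov_kernel MT MW K" and X: "markov_kernel (MW \<Otimes>\<^sub>M MT) MX X"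
    and t: "t \<in> space MT" and f: "f \<in> borel_measurable MX"
  shows "(\<integral>\<^sup>+x. f x \<partial>joint_kernel K X t) = (\<integral>\<^sup>+w. \<integral>\<^sup>+x. f x \<partial>X (w, t) \<partial>K t)"
proof -
  have "sets (K t) = sets MW"
    using K t by (simp add: markov_kernel_iff)
  then have "(\<lambda>w. X (w, t)) \<in> K t \<rightarrow>\<^sub>M subprob_algebra MX"
    using measurable_prob_algebraD[OF markov_kernel_section[OF X t]]
    by (simp cong: measurable_cong_sets)
  then show ?thesis
    unfolding joint_kernel_def by (rule nn_integral_bind[OF f])
qed

lemma emeasure_joint_kernel_tensor3:
  assumes K: "markov_kernel MT MW K" and X: "markov_kernel (MW \<Otimes>\<^sub>M MT) MX X"
    and Y: "markov_kernel (MW \<Otimes>\<^sub>M MT) MY Y" and Z: "markov_kernel (MW \<Otimes>\<^sub>M MT) MZ Z"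
    and t: "t \<in> space MT" and A: "A \<in> sets MX" and B: "B \<in> sets MY" and C: "C \<in> sets MZ"
  shows "emeasure (joint_kernel K (X \<otimes>\<^sub>K Y \<otimes>\<^sub>K Z) t) (A \<times> B \<times> C) =
    (\<integral>\<^sup>+w. emeasure (X (w, t)) A * (emeasure (Y (w, t)) B * emeasure (Z (w, t)) C) \<partial>K t)"
proof -
  have spK: "space (K t) = space MW"
    using K t by (intro sets_eq_imp_space_eq) (simp add: markov_kernel_iff)
  have "emeasure (joint_kernel K (X \<otimes>\<^sub>K Y \<otimes>\<^sub>K Z) t) (A \<times> B \<times> C) =
      (\<integral>\<^sup>+w. emeasure ((X \<otimes>\<^sub>K Y \<otimes>\<^sub>K Z) (w, t)) (A \<times> B \<times> C) \<partial>K t)"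
    using A B C
    by (intro emeasure_joint_kernel[OF K markov_kernel_tensor[OF X markov_kernel_tensor[OF Y Z]] t])
      auto
  also have "\<dots> = (\<integral>\<^sup>+w. emeasure (X (w, t)) A *
      (emeasure (Y (w, t)) B * emeasure (Z (w, t)) C) \<partial>K t)"
  proof (rule nn_integral_cong)
    fix w assume "w \<in> space (K t)"
    then have wt: "(w, t) \<in> space (MW \<Otimes>\<^sub>M MT)"
      using t by (simp add: spK space_pair_measure)
    interpret Y: prob_space "Y (w, t)" using Y wt by (simp add: markov_kernel_iff)
    interpret Z: prob_space "Z (w, t)" using Z wt by (simp add: markov_kernel_iff)
    interpret YZ: pair_prob_space "Y (w, t)" "Z (w, t)" ..
    have s: "sets (X (w, t)) = sets MX" "sets (Y (w, t)) = sets MY" "sets (Z (w, t)) = sets MZ"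
      using X Y Z wt by (simp_all add: markov_kernel_iff)
    show "emeasure ((X \<otimes>\<^sub>K Y \<otimes>\<^sub>K Z) (w, t)) (A \<times> B \<times> C) =
        emeasure (X (w, t)) A * (emeasure (Y (w, t)) B * emeasure (Z (w, t)) C)"
      using A B C s unfolding kernel_tensor_def
      by (simp add: YZ.emeasure_pair_measure_Times Z.emeasure_pair_measure_Times)
  qed
  finally show ?thesis .
qed

lemma nn_integral_tensor_indicator:
  assumes Y: "markov_kernel M MY Y" and Z: "markov_kernel M MZ Z" and p: "p \<in> space M"
    and B: "B \<in> sets MY" and f: "f \<in> borel_measurable MZ"
  shows "(\<integral>\<^sup>+yz. indicator B (fst yz) * f (snd yz) \<partial>(Y \<otimes>\<^sub>K Z) p) =
    emeasure (Y p) B * (\<integral>\<^sup>+z. f z \<partial>Z p)"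
proof -
  interpret Z: prob_space "Z p" using Z p by (simp add: markov_kernel_iff)
  have s: "sets (Y p) = sets MY" "sets (Z p) = sets MZ"
    using Y Z p by (simp_all add: markov_kernel_iff)
  have f': "f \<in> borel_measurable (Z p)" and B': "B \<in> sets (Y p)"
    using f B s by (simp_all cong: measurable_cong_sets)
  have "(\<integral>\<^sup>+yz. indicator B (fst yz) * f (snd yz) \<partial>(Y \<otimes>\<^sub>K Z) p) =
      (\<integral>\<^sup>+y. \<integral>\<^sup>+z. indicator B y * f z \<partial>Z p \<partial>Y p)"
    unfolding kernel_tensor_def using f' B'
    by (subst Z.nn_integral_fst[symmetric]) auto
  also have "\<dots> = emeasure (Y p) B * (\<integral>\<^sup>+z. f z \<partial>Z p)"
    using f' B' by (simp add: nn_integral_cmult nn_integral_multc)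
  finally show ?thesis .
qed

lemma distr_snd_joint_kernel:
  assumes K: "markov_kernel MT MW K" and X: "markov_kernel (MW \<Otimes>\<^sub>M MT) MX X"
    and U: "markov_kernel (MW \<Otimes>\<^sub>M MT) MU U" and t: "t \<in> space MT"
  shows "distr (joint_kernel K (X \<otimes>\<^sub>K U) t) MU snd = joint_kernel K U t"
proof (rule measure_eqI)
  have XU: "markov_kernel (MW \<Otimes>\<^sub>M MT) (MX \<Otimes>\<^sub>M MU) (X \<otimes>\<^sub>K U)"
    by (rule markov_kernel_tensor[OF X U])
  have s: "sets (joint_kernel K (X \<otimes>\<^sub>K U) t) = sets (MX \<Otimes>\<^sub>M MU)"
      "sets (joint_kernel K U t) = sets MU"
    using markov_kernel_joint_kernel[OF K XU] markov_kernel_joint_kernel[OF K U] t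
    by (simp_all add: markov_kernel_iff)
  have spK: "space (K t) = space MW"
    using K t by (intro sets_eq_imp_space_eq) (simp add: markov_kernel_iff)
  show "sets (distr (joint_kernel K (X \<otimes>\<^sub>K U) t) MU snd) = sets (joint_kernel K U t)"
    by (simp add: s)
  fix E assume "E \<in> sets (distr (joint_kernel K (X \<otimes>\<^sub>K U) t) MU snd)"
  then have E: "E \<in> sets MU" by simp
  have "emeasure (distr (joint_kernel K (X \<otimes>\<^sub>K U) t) MU snd) E =
      emeasure (joint_kernel K (X \<otimes>\<^sub>K U) t) (space MX \<times> E)"
  proof -
    have "snd -` E \<inter> space (joint_kernel K (X \<otimes>\<^sub>K U) t) = space MX \<times> E"
      using sets_eq_imp_space_eq[OF s(1)] sets.sets_into_space[OF E]
      by (auto simp: space_pair_measure)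
    moreover have "snd \<in> joint_kernel K (X \<otimes>\<^sub>K U) t \<rightarrow>\<^sub>M MU"
      using s by (simp cong: measurable_cong_sets)
    ultimately show ?thesis
      using E by (simp add: emeasure_distr)
  qed
  also have "\<dots> = (\<integral>\<^sup>+w. emeasure ((X \<otimes>\<^sub>K U) (w, t)) (space MX \<times> E) \<partial>K t)"
    using E by (intro emeasure_joint_kernel[OF K XU t]) auto
  also have "\<dots> = (\<integral>\<^sup>+w. emeasure (U (w, t)) E \<partial>K t)"
  proof (rule nn_integral_cong)
    fix w assume "w \<in> space (K t)"
    then have wt: "(w, t) \<in> space (MW \<Otimes>\<^sub>M MT)"
      using t by (simp add: spK space_pair_measure)
    interpret X: prob_space "X (w, t)" using X wt by (simp add: markov_kernel_iff)
    interpret U: prob_space "U (w, t)" using U wt by (simp add: markov_kernel_iff)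
    have s: "sets (X (w, t)) = sets MX" "sets (U (w, t)) = sets MU"
      using X U wt by (simp_all add: markov_kernel_iff)
    have "emeasure ((X \<otimes>\<^sub>K U) (w, t)) (space (X (w, t)) \<times> E) = emeasure (U (w, t)) E"
      using E s unfolding kernel_tensor_def
      by (subst U.emeasure_pair_measure_Times) (auto simp: X.emeasure_space_1)
    then show "emeasure ((X \<otimes>\<^sub>K U) (w, t)) (space MX \<times> E) = emeasure (U (w, t)) E"
      by (simp add: sets_eq_imp_space_eq[OF s(1)])
  qed
  also have "\<dots> = emeasure (joint_kernel K U t) E"
    by (rule emeasure_joint_kernel[OF K U t E, symmetric])
  finally show "emeasure (distr (joint_kernel K (X \<otimes>\<^sub>K U) t) MU snd) E =
      emeasure (joint_kernel K U t) E" .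
qed

lemma markov_kernel_product:
  assumes Q: "markov_kernel MZ MX Q" and K: "markov_kernel MT (MY \<Otimes>\<^sub>M MZ) K"
  shows "markov_kernel MT (MX \<Otimes>\<^sub>M MY \<Otimes>\<^sub>M MZ) (kernel_product Q K)"
proof -
  have Qs: "(\<lambda>yz. Q (snd yz)) \<in> MY \<Otimes>\<^sub>M MZ \<rightarrow>\<^sub>M prob_algebra MX"
    using Q by measurable
  have R: "return (MY \<Otimes>\<^sub>M MZ) \<in> MY \<Otimes>\<^sub>M MZ \<rightarrow>\<^sub>M prob_algebra (MY \<Otimes>\<^sub>M MZ)"
    by (rule measurable_return_prob_space)
  have "(\<lambda>yz. Q (snd yz) \<Otimes>\<^sub>M return (MY \<Otimes>\<^sub>M MZ) yz) \<in>
      MY \<Otimes>\<^sub>M MZ \<rightarrow>\<^sub>M prob_algebra (MX \<Otimes>\<^sub>M MY \<Otimes>\<^sub>M MZ)"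
    using Qs R by measurable
  then have "(\<lambda>t. K t \<bind> (\<lambda>yz. Q (snd yz) \<Otimes>\<^sub>M return (MY \<Otimes>\<^sub>M MZ) yz)) \<in>
      MT \<rightarrow>\<^sub>M prob_algebra (MX \<Otimes>\<^sub>M MY \<Otimes>\<^sub>M MZ)"
    by (rule measurable_bind_prob_space[OF K])
  moreover have "kernel_product Q K t = K t \<bind> (\<lambda>yz. Q (snd yz) \<Otimes>\<^sub>M return (MY \<Otimes>\<^sub>M MZ) yz)"
    if "t \<in> space MT" for t
    using return_sets_cong[of "K t" "MY \<Otimes>\<^sub>M MZ"] K that
    by (simp add: kernel_product_def markov_kernel_iff)
  ultimately show ?thesis
    by (simp cong: measurable_cong)
qed

section \<open>Conditional independence as an identity of integrals\<close>

text \<open>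
  Since \<open>X\<close>, \<open>Y\<close> and \<open>Z\<close> are independent given \<open>(w, t)\<close>, the joint kernel and the kernel product
  factorise on boxes inside the integral over \<open>w\<close>. In this form, exchanging \<open>X\<close> and \<open>Y\<close> in the joint
  kernel amounts to commuting two factors, instead of permuting coordinates of a product space.
\<close>

lemma trans_cond_indep_iff_rectangles:
  assumes K: "markov_kernel MT MW K" and X: "markov_kernel (MW \<Otimes>\<^sub>M MT) MX X"
    and Y: "markov_kernel (MW \<Otimes>\<^sub>M MT) MY Y" and Z: "markov_kernel (MW \<Otimes>\<^sub>M MT) MZ Z"
  shows "trans_cond_indep MT K MX X MY Y MZ Z \<longleftrightarrow>
    (\<exists>Q. markov_kernel MZ MX Q \<and>
      (\<forall>t\<in>space MT. \<forall>A\<in>sets MX. \<forall>B\<in>sets MY. \<forall>C\<in>sets MZ.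
        (\<integral>\<^sup>+w. emeasure (X (w, t)) A * (emeasure (Y (w, t)) B * emeasure (Z (w, t)) C) \<partial>K t) =
        (\<integral>\<^sup>+w. emeasure (Y (w, t)) B *
          (\<integral>\<^sup>+z. emeasure (Q z) A * indicator C z \<partial>Z (w, t)) \<partial>K t)))"
proof -
  let ?J = "joint_kernel K (X \<otimes>\<^sub>K Y \<otimes>\<^sub>K Z)"
  let ?D = "\<lambda>t. distr (?J t) (MY \<Otimes>\<^sub>M MZ) snd"
  have YZ: "markov_kernel (MW \<Otimes>\<^sub>M MT) (MY \<Otimes>\<^sub>M MZ) (Y \<otimes>\<^sub>K Z)"
    by (rule markov_kernel_tensor[OF Y Z])
  have J: "markov_kernel MT (MX \<Otimes>\<^sub>M MY \<Otimes>\<^sub>M MZ) ?J"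
    by (intro markov_kernel_joint_kernel[OF K] markov_kernel_tensor X YZ)
  have D_eq: "?D t = joint_kernel K (Y \<otimes>\<^sub>K Z) t" if "t \<in> space MT" for t
    by (rule distr_snd_joint_kernel[OF K X YZ that])
  have D: "markov_kernel MT (MY \<Otimes>\<^sub>M MZ) ?D"
    using markov_kernel_joint_kernel[OF K YZ] by (simp add: D_eq cong: measurable_cong)
  have spK: "space (K t) = space MW" if "t \<in> space MT" for t
    using K that by (intro sets_eq_imp_space_eq) (simp add: markov_kernel_iff)
  have rect: "emeasure (kernel_product Q ?D t) (A \<times> B \<times> C) =
      (\<integral>\<^sup>+w. emeasure (Y (w, t)) B * (\<integral>\<^sup>+z. emeasure (Q z) A * indicator C z \<partial>Z (w, t)) \<partial>K t)"
    if Q: "markov_kernel MZ MX Q" and t: "t \<in> space MT"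
      and A: "A \<in> sets MX" and B: "B \<in> sets MY" and C: "C \<in> sets MZ" for Q t A B C
  proof -
    have QA: "(\<lambda>z. emeasure (Q z) A * indicator C z) \<in> borel_measurable MZ"
      using measurable_emeasure_kernel[OF measurable_prob_algebraD[OF Q] A] C by measurable
    have m: "(\<lambda>yz. indicator B (fst yz) * (emeasure (Q (snd yz)) A * indicator C (snd yz)))
        \<in> borel_measurable (MY \<Otimes>\<^sub>M MZ)"
      using B measurable_compose[OF measurable_snd QA] by measurable
    have "emeasure (kernel_product Q ?D t) (A \<times> B \<times> C) =
        (\<integral>\<^sup>+yz. indicator B (fst yz) * (emeasure (Q (snd yz)) A * indicator C (snd yz))
          \<partial>joint_kernel K (Y \<otimes>\<^sub>K Z) t)"
      by (simp add: emeasure_kernel_product[OF Q D t A B C] D_eq[OF t] ac_simps)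
    also have "\<dots> = (\<integral>\<^sup>+w. \<integral>\<^sup>+yz. indicator B (fst yz) *
        (emeasure (Q (snd yz)) A * indicator C (snd yz)) \<partial>(Y \<otimes>\<^sub>K Z) (w, t) \<partial>K t)"
      by (rule nn_integral_joint_kernel[OF K YZ t m])
    also have "\<dots> = (\<integral>\<^sup>+w. emeasure (Y (w, t)) B *
        (\<integral>\<^sup>+z. emeasure (Q z) A * indicator C z \<partial>Z (w, t)) \<partial>K t)"
      using t spK by (intro nn_integral_cong nn_integral_tensor_indicator[OF Y Z _ B QA])
        (simp add: space_pair_measure)
    finally show ?thesis .
  qed
  have "?J t = kernel_product Q ?D t \<longleftrightarrow>
      (\<forall>A\<in>sets MX. \<forall>B\<in>sets MY. \<forall>C\<in>sets MZ.
        (\<integral>\<^sup>+w. emeasure (X (w, t)) A * (emeasure (Y (w, t)) B * emeasure (Z (w, t)) C) \<partial>K t) =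
        (\<integral>\<^sup>+w. emeasure (Y (w, t)) B *
          (\<integral>\<^sup>+z. emeasure (Q z) A * indicator C z \<partial>Z (w, t)) \<partial>K t))"
    if Q: "markov_kernel MZ MX Q" and t: "t \<in> space MT" for Q t
  proof -
    have "?J t = kernel_product Q ?D t \<longleftrightarrow>
      (\<forall>A\<in>sets MX. \<forall>B\<in>sets MY. \<forall>C\<in>sets MZ.
        emeasure (?J t) (A \<times> B \<times> C) = emeasure (kernel_product Q ?D t) (A \<times> B \<times> C))"
      using measure_eqI_prob_triple[OF measurable_space[OF J t]
          measurable_space[OF markov_kernel_product[OF Q D] t]] by auto
    then show ?thesis
      using t by (simp add: rect[OF Q t] emeasure_joint_kernel_tensor3[OF K X Y Z t])
  qed
  then show ?thesis
    unfolding trans_cond_indep_def by blast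
qed

text \<open>
  The one-point space has just two events, and the empty one contributes \<open>0 = 0\<close>. What remains is
  that \<open>P\<close> is a conditional distribution of \<open>Y\<close> given \<open>Z\<close> which does not depend on \<open>t\<close>.
\<close>

lemma trans_cond_indep_delta_star_iff:
  assumes K: "markov_kernel MT MW K"
    and Y: "markov_kernel (MW \<Otimes>\<^sub>M MT) MY Y" and Z: "markov_kernel (MW \<Otimes>\<^sub>M MT) MZ Z"
  shows "trans_cond_indep MT K MY Y point_space delta_star MZ Z \<longleftrightarrow>
    (\<exists>P. markov_kernel MZ MY P \<and>
      (\<forall>t\<in>space MT. \<forall>B\<in>sets MY. \<forall>C\<in>sets MZ.
        (\<integral>\<^sup>+w. emeasure (Y (w, t)) B * emeasure (Z (w, t)) C \<partial>K t) =
        (\<integral>\<^sup>+w. \<integral>\<^sup>+z. emeasure (P z) B * indicator C z \<partial>Z (w, t) \<partial>K t)))"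
proof -
  have D: "markov_kernel (MW \<Otimes>\<^sub>M MT) point_space delta_star"
    unfolding delta_star_def
    by (intro measurable_const) (simp add: space_prob_algebra prob_space_return)
  have all_unit: "(\<forall>B\<in>sets point_space. R B) \<longleftrightarrow> R {} \<and> R {()}" for R
  proof -
    have "sets point_space = {{}, {()}}"
      by (simp only: sets_count_space UNIV_unit Pow_insert Pow_empty) auto
    then show ?thesis by (rule ssubst) blast
  qed
  show ?thesis
    unfolding trans_cond_indep_iff_rectangles[OF K Y D Z] all_unit
    by (simp add: delta_star_def)
qed

section \<open>Restricted symmetry\<close>

text \<open>
  The conditional distribution \<open>P\<close> of \<open>Y\<close> given \<open>Z\<close> from the second independence is the witness for
  the exchanged variables.
\<close>

lemma trans_cond_indep_restricted_symmetry:
  assumes K: "markov_kernel MT MW K" and X: "markov_kernel (MW \<Otimes>\<^sub>M MT) MX X"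
    and Y: "markov_kernel (MW \<Otimes>\<^sub>M MT) MY Y" and Z: "markov_kernel (MW \<Otimes>\<^sub>M MT) MZ Z"
    and XY: "trans_cond_indep MT K MX X MY Y MZ Z"
    and Yd: "trans_cond_indep MT K MY Y point_space delta_star MZ Z"
  shows "trans_cond_indep MT K MY Y MX X MZ Z"
proof -
  obtain Q where Q: "markov_kernel MZ MX Q"
    and Q_eq: "\<And>t A B C. t \<in> space MT \<Longrightarrow> A \<in> sets MX \<Longrightarrow> B \<in> sets MY \<Longrightarrow> C \<in> sets MZ \<Longrightarrow>
        (\<integral>\<^sup>+w. emeasure (X (w, t)) A * (emeasure (Y (w, t)) B * emeasure (Z (w, t)) C) \<partial>K t) =
        (\<integral>\<^sup>+w. emeasure (Y (w, t)) B *
          (\<integral>\<^sup>+z. emeasure (Q z) A * indicator C z \<partial>Z (w, t)) \<partial>K t)"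
    using XY unfolding trans_cond_indep_iff_rectangles[OF K X Y Z] by blast
  obtain P where P: "markov_kernel MZ MY P"
    and P_eq: "\<And>t B C. t \<in> space MT \<Longrightarrow> B \<in> sets MY \<Longrightarrow> C \<in> sets MZ \<Longrightarrow>
        (\<integral>\<^sup>+w. emeasure (Y (w, t)) B * emeasure (Z (w, t)) C \<partial>K t) =
        (\<integral>\<^sup>+w. \<integral>\<^sup>+z. emeasure (P z) B * indicator C z \<partial>Z (w, t) \<partial>K t)"
    using Yd unfolding trans_cond_indep_delta_star_iff[OF K Y Z] by blast
  have "(\<integral>\<^sup>+w. emeasure (Y (w, t)) B * (emeasure (X (w, t)) A * emeasure (Z (w, t)) C) \<partial>K t) =
      (\<integral>\<^sup>+w. emeasure (X (w, t)) A *
          (\<integral>\<^sup>+z. emeasure (P z) B * indicator C z \<partial>Z (w, t)) \<partial>K t)"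
    if t: "t \<in> space MT" and A: "A \<in> sets MX" and B: "B \<in> sets MY" and C: "C \<in> sets MZ" for t A B C
  proof -
    let ?q = "\<lambda>z. emeasure (Q z) A" and ?p = "\<lambda>z. emeasure (P z) B"
    have Kt: "prob_space (K t)" "sets (K t) = sets MW"
      using K t by (simp_all add: markov_kernel_iff)
    have spK: "space (K t) = space MW"
      by (rule sets_eq_imp_space_eq) (rule Kt(2))
    have ne: "space (K t) \<noteq> {}"
      by (rule prob_space.not_empty[OF Kt(1)])
    have N: "(\<lambda>w. Z (w, t)) \<in> K t \<rightarrow>\<^sub>M subprob_algebra MZ"
      using measurable_prob_algebraD[OF markov_kernel_section[OF Z t]] Kt(2)
      by (simp cong: measurable_cong_sets)
    have a: "(\<lambda>w. emeasure (X (w, t)) A) \<in> borel_measurable (K t)"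
        "(\<lambda>w. emeasure (Y (w, t)) B) \<in> borel_measurable (K t)"
      using markov_kernel_section[OF X t] markov_kernel_section[OF Y t] A B Kt(2)
      by (simp_all add: markov_kernel_iff cong: measurable_cong_sets)
    have q: "?q \<in> borel_measurable MZ" and p: "?p \<in> borel_measurable MZ"
      using Q P A B by (simp_all add: markov_kernel_iff)
    \<comment> \<open>Marginalising \<open>Y\<close> out of the first independence: \<open>Q\<close> is a conditional distribution of \<open>X\<close> given \<open>Z\<close>.\<close>
    have X_eq: "(\<integral>\<^sup>+w. emeasure (X (w, t)) A * emeasure (Z (w, t)) C' \<partial>K t) =
        (\<integral>\<^sup>+w. \<integral>\<^sup>+z. ?q z * indicator C' z \<partial>Z (w, t) \<partial>K t)" if C': "C' \<in> sets MZ" for C'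
    proof -
      have "emeasure (Y (w, t)) (space MY) = 1" if w: "w \<in> space (K t)" for w
      proof -
        have "prob_space (Y (w, t))" "space (Y (w, t)) = space MY"
          using markov_kernel_section[OF Y t] w spK
          by (auto simp: markov_kernel_iff dest: sets_eq_imp_space_eq)
        then show ?thesis
          using prob_space.emeasure_space_1 by metis
      qed
      then show ?thesis
        using Q_eq[OF t A sets.top C'] by (simp cong: nn_integral_cong)
    qed
    have "(\<integral>\<^sup>+w. emeasure (Y (w, t)) B * (emeasure (X (w, t)) A * emeasure (Z (w, t)) C) \<partial>K t) =
        (\<integral>\<^sup>+w. emeasure (Y (w, t)) B * (\<integral>\<^sup>+z. ?q z * indicator C z \<partial>Z (w, t)) \<partial>K t)"
      using Q_eq[OF t A B C] by (simp add: ac_simps)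
    also have "\<dots> = (\<integral>\<^sup>+w. \<integral>\<^sup>+z. ?p z * (?q z * indicator C z) \<partial>Z (w, t) \<partial>K t)"
      using q C by (intro nn_integral_weighted_mixture[OF a(2) N ne p _ P_eq[OF t B]]) auto
    also have "\<dots> = (\<integral>\<^sup>+w. \<integral>\<^sup>+z. ?q z * (?p z * indicator C z) \<partial>Z (w, t) \<partial>K t)"
      by (simp add: ac_simps)
    also have "\<dots> = (\<integral>\<^sup>+w. emeasure (X (w, t)) A *
        (\<integral>\<^sup>+z. ?p z * indicator C z \<partial>Z (w, t)) \<partial>K t)"
      using p C by (intro nn_integral_weighted_mixture[OF a(1) N ne q _ X_eq, symmetric]) auto
    finally show ?thesis .
  qed
  then show ?thesis
    unfolding trans_cond_indep_iff_rectangles[OF K Y X Z] using P by blast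
qed

section \<open>Symmetry from disintegration\<close>

text \<open>
  The disintegration of \<open>K(Y, Z | T)\<close>, with its integrals over the marginal \<open>K(Z | T)\<close> rewritten as
  integrals over \<open>w\<close>. The result differs from the condition in \<open>trans_cond_indep_delta_star_iff\<close>
  only in that \<open>L\<close> sees \<open>t\<close>.
\<close>

lemma disintegration_triple_joint_kernel:
  assumes dis: "disintegration_triple MY MZ MT" and K: "markov_kernel MT MW K"
    and Y: "markov_kernel (MW \<Otimes>\<^sub>M MT) MY Y" and Z: "markov_kernel (MW \<Otimes>\<^sub>M MT) MZ Z"
  obtains L where "markov_kernel (MZ \<Otimes>\<^sub>M MT) MY L"
    and "\<And>t B C. t \<in> space MT \<Longrightarrow> B \<in> sets MY \<Longrightarrow> C \<in> sets MZ \<Longrightarrow>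
        (\<integral>\<^sup>+w. emeasure (Y (w, t)) B * emeasure (Z (w, t)) C \<partial>K t) =
        (\<integral>\<^sup>+w. \<integral>\<^sup>+z. emeasure (L (z, t)) B * indicator C z \<partial>Z (w, t) \<partial>K t)"
proof -
  let ?J = "joint_kernel K (Y \<otimes>\<^sub>K Z)"
  have YZ: "markov_kernel (MW \<Otimes>\<^sub>M MT) (MY \<Otimes>\<^sub>M MZ) (Y \<otimes>\<^sub>K Z)"
    by (rule markov_kernel_tensor[OF Y Z])
  obtain L where L: "markov_kernel (MZ \<Otimes>\<^sub>M MT) MY L"
    and L_eq: "\<And>t B C. t \<in> space MT \<Longrightarrow> B \<in> sets MY \<Longrightarrow> C \<in> sets MZ \<Longrightarrow>
        emeasure (?J t) (B \<times> C) = (\<integral>\<^sup>+z\<in>C. emeasure (L (z, t)) B \<partial>distr (?J t) MZ snd)"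
    using dis markov_kernel_joint_kernel[OF K YZ] unfolding disintegration_triple_def by blast
  show thesis
  proof (rule that[OF L])
    fix t B C assume t: "t \<in> space MT" and B: "B \<in> sets MY" and C: "C \<in> sets MZ"
    have spK: "space (K t) = space MW"
      using K t by (intro sets_eq_imp_space_eq) (simp add: markov_kernel_iff)
    have LB: "(\<lambda>z. emeasure (L (z, t)) B * indicator C z) \<in> borel_measurable MZ"
      using measurable_emeasure_kernel[OF measurable_prob_algebraD[OF markov_kernel_section[OF L t]] B] C
      by measurable
    have "(\<integral>\<^sup>+w. emeasure (Y (w, t)) B * emeasure (Z (w, t)) C \<partial>K t) =
        (\<integral>\<^sup>+w. emeasure ((Y \<otimes>\<^sub>K Z) (w, t)) (B \<times> C) \<partial>K t)"
    proof (rule nn_integral_cong)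
      fix w assume "w \<in> space (K t)"
      then have wt: "(w, t) \<in> space (MW \<Otimes>\<^sub>M MT)"
        using t by (simp add: spK space_pair_measure)
      interpret Z: prob_space "Z (w, t)" using Z wt by (simp add: markov_kernel_iff)
      show "emeasure (Y (w, t)) B * emeasure (Z (w, t)) C =
          emeasure ((Y \<otimes>\<^sub>K Z) (w, t)) (B \<times> C)"
        using Y Z wt B C unfolding kernel_tensor_def
        by (simp add: Z.emeasure_pair_measure_Times markov_kernel_iff)
    qed
    also have "\<dots> = emeasure (?J t) (B \<times> C)"
      using B C by (intro emeasure_joint_kernel[OF K YZ t, symmetric]) auto
    also have "\<dots> = (\<integral>\<^sup>+z. emeasure (L (z, t)) B * indicator C z \<partial>joint_kernel K Z t)"
      by (simp add: L_eq[OF t B C] distr_snd_joint_kernel[OF K Y Z t])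
    also have "\<dots> = (\<integral>\<^sup>+w. \<integral>\<^sup>+z. emeasure (L (z, t)) B * indicator C z \<partial>Z (w, t) \<partial>K t)"
      by (rule nn_integral_joint_kernel[OF K Z t LB])
    finally show "(\<integral>\<^sup>+w. emeasure (Y (w, t)) B * emeasure (Z (w, t)) C \<partial>K t) =
        (\<integral>\<^sup>+w. \<integral>\<^sup>+z. emeasure (L (z, t)) B * indicator C z \<partial>Z (w, t) \<partial>K t)" .
  qed
qed

lemma markov_kernel_T_kernel: "markov_kernel (MW \<Otimes>\<^sub>M MT) MT (T_kernel MT)"
  unfolding T_kernel_def case_prod_beta'
  by (rule measurable_compose[OF measurable_snd measurable_return_prob_space])

lemma nn_integral_tensor_T_kernel:
  assumes Z: "markov_kernel (MW \<Otimes>\<^sub>M MT) MZ Z" and w: "w \<in> space MW" and t: "t \<in> space MT"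
    and f: "f \<in> borel_measurable (MZ \<Otimes>\<^sub>M MT)"
  shows "(\<integral>\<^sup>+zs. f zs \<partial>(Z \<otimes>\<^sub>K T_kernel MT) (w, t)) = (\<integral>\<^sup>+z. f (z, t) \<partial>Z (w, t))"
proof -
  have s: "sets (Z (w, t)) = sets MZ"
    using markov_kernel_section[OF Z t] w by (simp add: markov_kernel_iff)
  interpret T: prob_space "return MT t" by (rule prob_space_return[OF t])
  have "sets (Z (w, t) \<Otimes>\<^sub>M return MT t) = sets (MZ \<Otimes>\<^sub>M MT)"
    by (intro sets_pair_measure_cong) (simp_all add: s)
  then have "f \<in> borel_measurable (Z (w, t) \<Otimes>\<^sub>M return MT t)"
    using f by (simp cong: measurable_cong_sets)
  then have "(\<integral>\<^sup>+zs. f zs \<partial>(Z \<otimes>\<^sub>K T_kernel MT) (w, t)) =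
      (\<integral>\<^sup>+z. \<integral>\<^sup>+s. f (z, s) \<partial>return MT t \<partial>Z (w, t))"
    by (simp add: kernel_tensor_def T_kernel_def T.nn_integral_fst)
  also have "\<dots> = (\<integral>\<^sup>+z. f (z, t) \<partial>Z (w, t))"
  proof (intro nn_integral_cong nn_integral_return[OF t])
    fix z assume "z \<in> space (Z (w, t))"
    then have "z \<in> space MZ" by (simp add: sets_eq_imp_space_eq[OF s])
    then show "(\<lambda>s. f (z, s)) \<in> borel_measurable MT"
      using f by measurable
  qed
  finally show ?thesis .
qed

text \<open>
  Given \<open>t\<close>, the variable \<open>Z \<otimes>\<^sub>K T_kernel MT\<close> is concentrated on the pairs \<open>(z, t)\<close>, so \<open>L\<close> itself
  is a kernel from the conditioning space, and an event \<open>E\<close> of the product may be replaced by its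
  section at \<open>t\<close>.
\<close>

lemma trans_cond_indep_delta_star_of_disintegration:
  assumes dis: "disintegration_triple MY MZ MT" and K: "markov_kernel MT MW K"
    and Y: "markov_kernel (MW \<Otimes>\<^sub>M MT) MY Y" and Z: "markov_kernel (MW \<Otimes>\<^sub>M MT) MZ Z"
  shows "trans_cond_indep MT K MY Y point_space delta_star (MZ \<Otimes>\<^sub>M MT) (Z \<otimes>\<^sub>K T_kernel MT)"
proof -
  let ?ZT = "Z \<otimes>\<^sub>K T_kernel MT"
  have ZT: "markov_kernel (MW \<Otimes>\<^sub>M MT) (MZ \<Otimes>\<^sub>M MT) ?ZT"
    by (rule markov_kernel_tensor[OF Z markov_kernel_T_kernel])
  obtain L where L: "markov_kernel (MZ \<Otimes>\<^sub>M MT) MY L"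
    and L_eq: "\<And>t B C. t \<in> space MT \<Longrightarrow> B \<in> sets MY \<Longrightarrow> C \<in> sets MZ \<Longrightarrow>
        (\<integral>\<^sup>+w. emeasure (Y (w, t)) B * emeasure (Z (w, t)) C \<partial>K t) =
        (\<integral>\<^sup>+w. \<integral>\<^sup>+z. emeasure (L (z, t)) B * indicator C z \<partial>Z (w, t) \<partial>K t)"
    using disintegration_triple_joint_kernel[OF dis K Y Z] by blast
  have "(\<integral>\<^sup>+w. emeasure (Y (w, t)) B * emeasure (?ZT (w, t)) E \<partial>K t) =
      (\<integral>\<^sup>+w. \<integral>\<^sup>+zs. emeasure (L zs) B * indicator E zs \<partial>?ZT (w, t) \<partial>K t)"
    if t: "t \<in> space MT" and B: "B \<in> sets MY" and E: "E \<in> sets (MZ \<Otimes>\<^sub>M MT)" for t B E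
  proof -
    let ?E = "{z \<in> space MZ. (z, t) \<in> E}"
    have E': "?E \<in> sets MZ"
      using sets_Pair2[OF E, of t] sets.sets_into_space[OF E]
      by (auto simp: space_pair_measure vimage_def elim!: back_subst[of "\<lambda>S. S \<in> sets MZ"])
    have spK: "space (K t) = space MW"
      using K t by (intro sets_eq_imp_space_eq) (simp add: markov_kernel_iff)
    have ind: "(\<integral>\<^sup>+zs. f zs * indicator E zs \<partial>?ZT (w, t)) =
        (\<integral>\<^sup>+z. f (z, t) * indicator ?E z \<partial>Z (w, t))"
      if w: "w \<in> space (K t)" and f: "f \<in> borel_measurable (MZ \<Otimes>\<^sub>M MT)" for w f
    proof -
      have s: "sets (Z (w, t)) = sets MZ"
        using markov_kernel_section[OF Z t] w spK by (simp add: markov_kernel_iff)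
      have "(\<integral>\<^sup>+zs. f zs * indicator E zs \<partial>?ZT (w, t)) =
          (\<integral>\<^sup>+z. f (z, t) * indicator E (z, t) \<partial>Z (w, t))"
        using w t f E spK by (intro nn_integral_tensor_T_kernel[OF Z]) auto
      also have "\<dots> = (\<integral>\<^sup>+z. f (z, t) * indicator ?E z \<partial>Z (w, t))"
        by (intro nn_integral_cong) (auto simp: sets_eq_imp_space_eq[OF s] split: split_indicator)
      finally show ?thesis .
    qed
    have "emeasure (?ZT (w, t)) E = emeasure (Z (w, t)) ?E" if w: "w \<in> space (K t)" for w
    proof -
      have "sets (Z (w, t)) = sets MZ" "sets (?ZT (w, t)) = sets (MZ \<Otimes>\<^sub>M MT)"
        using markov_kernel_section[OF Z t] markov_kernel_section[OF ZT t] w spK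
        by (simp_all add: markov_kernel_iff)
      then show ?thesis
        using ind[OF w measurable_const[of 1]] E E' by simp
    qed
    then have "(\<integral>\<^sup>+w. emeasure (Y (w, t)) B * emeasure (?ZT (w, t)) E \<partial>K t) =
        (\<integral>\<^sup>+w. emeasure (Y (w, t)) B * emeasure (Z (w, t)) ?E \<partial>K t)"
      by (simp cong: nn_integral_cong)
    also have "\<dots> = (\<integral>\<^sup>+w. \<integral>\<^sup>+z. emeasure (L (z, t)) B * indicator ?E z \<partial>Z (w, t) \<partial>K t)"
      by (rule L_eq[OF t B E'])
    also have "\<dots> = (\<integral>\<^sup>+w. \<integral>\<^sup>+zs. emeasure (L zs) B * indicator E zs \<partial>?ZT (w, t) \<partial>K t)"
      using L B by (intro nn_integral_cong ind[symmetric]) (simp_all add: markov_kernel_iff)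
    finally show ?thesis .
  qed
  then show ?thesis
    unfolding trans_cond_indep_delta_star_iff[OF K Y ZT] using L by blast
qed

text \<open>
  With a single parameter \<open>s\<close>, freezing the second argument of \<open>L\<close> at \<open>s\<close> loses nothing.
\<close>

lemma trans_cond_indep_delta_star_of_disintegration_singleton:
  assumes s: "space MT = {s}"
    and dis: "disintegration_triple MY MZ MT" and K: "markov_kernel MT MW K"
    and Y: "markov_kernel (MW \<Otimes>\<^sub>M MT) MY Y" and Z: "markov_kernel (MW \<Otimes>\<^sub>M MT) MZ Z"
  shows "trans_cond_indep MT K MY Y point_space delta_star MZ Z"
proof -
  obtain L where L: "markov_kernel (MZ \<Otimes>\<^sub>M MT) MY L"
    and L_eq: "\<And>t B C. t \<in> space MT \<Longrightarrow> B \<in> sets MY \<Longrightarrow> C \<in> sets MZ \<Longrightarrow>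
        (\<integral>\<^sup>+w. emeasure (Y (w, t)) B * emeasure (Z (w, t)) C \<partial>K t) =
        (\<integral>\<^sup>+w. \<integral>\<^sup>+z. emeasure (L (z, t)) B * indicator C z \<partial>Z (w, t) \<partial>K t)"
    using disintegration_triple_joint_kernel[OF dis K Y Z] by blast
  have "markov_kernel MZ MY (\<lambda>z. L (z, s))"
    using L s by (intro markov_kernel_section) auto
  then show ?thesis
    unfolding trans_cond_indep_delta_star_iff[OF K Y Z]
    using L_eq s by (intro exI[of _ "\<lambda>z. L (z, s)"]) auto
qed

theorem corollary3p16:
  fixes MW :: "'w measure" and MT :: "'t measure"
    and MX :: "'x measure" and MY :: "'y measure" and MZ :: "'z measure"
    and K :: "'t \<Rightarrow> 'w measure"
    and X :: "'w \<times> 't \<Rightarrow> 'x measure"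
    and Y :: "'w \<times> 't \<Rightarrow> 'y measure"
    and Z :: "'w \<times> 't \<Rightarrow> 'z measure"
  assumes K: "markov_kernel MT MW K"
    and X: "markov_kernel (MW \<Otimes>\<^sub>M MT) MX X"
    and Y: "markov_kernel (MW \<Otimes>\<^sub>M MT) MY Y"
    and Z: "markov_kernel (MW \<Otimes>\<^sub>M MT) MZ Z"
  shows
    "(trans_cond_indep MT K MX X MY Y MZ Z \<and>
      trans_cond_indep MT K MY Y point_space delta_star MZ Z \<longrightarrow>
      trans_cond_indep MT K MY Y MX X MZ Z) \<and>
     (disintegration_triple MY MZ MT \<longrightarrow>
      trans_cond_indep MT K MX X MY Y (MZ \<Otimes>\<^sub>M MT) (Z \<otimes>\<^sub>K T_kernel MT) \<longrightarrow>
      trans_cond_indep MT K MY Y MX X (MZ \<Otimes>\<^sub>M MT) (Z \<otimes>\<^sub>K T_kernel MT)) \<and>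
     ((\<exists>s. space MT = {s}) \<and> disintegration_triple MY MZ MT \<longrightarrow>
      trans_cond_indep MT K MX X MY Y MZ Z \<longrightarrow>
      trans_cond_indep MT K MY Y MX X MZ Z)"


proof (intro conjI impI)
  assume "trans_cond_indep MT K MX X MY Y MZ Z \<and>
      trans_cond_indep MT K MY Y point_space delta_star MZ Z"
  then show "trans_cond_indep MT K MY Y MX X MZ Z"
    using trans_cond_indep_restricted_symmetry[OF K X Y Z] by blast
next
  assume "disintegration_triple MY MZ MT"
    and "trans_cond_indep MT K MX X MY Y (MZ \<Otimes>\<^sub>M MT) (Z \<otimes>\<^sub>K T_kernel MT)"
  then show "trans_cond_indep MT K MY Y MX X (MZ \<Otimes>\<^sub>M MT) (Z \<otimes>\<^sub>K T_kernel MT)"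
    by (intro trans_cond_indep_restricted_symmetry[OF K X Y]
        trans_cond_indep_delta_star_of_disintegration[OF _ K Y Z]
        markov_kernel_tensor Z markov_kernel_T_kernel)
next
  assume "(\<exists>s. space MT = {s}) \<and> disintegration_triple MY MZ MT"
    and "trans_cond_indep MT K MX X MY Y MZ Z"
  then show "trans_cond_indep MT K MY Y MX X MZ Z"
    using trans_cond_indep_restricted_symmetry[OF K X Y Z]
      trans_cond_indep_delta_star_of_disintegration_singleton[OF _ _ K Y Z] by blast
qed

end
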